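(* Let $f\in L^1(0,T;\mathcal{H}_{\mathrm r})$ and $x_0\in\mathcal{H}_{\mathrm r}$. For $i=1,2$ let $\mathfrak R_i=(S_i,B_i,C_i,y_{0,i},g_i)$ be hidden realisations on $[0,T]$ with induced pairs $(K_i,F_{\mathrm u,i})$, and let $x_i\in\mathcal{C}([0,T];\mathcal{H}_{\mathrm r})$ be the mild solutions of $$\frac{d}{dt}x_i(t)=Ax_i(t)+(K_i*x_i)(t)+F_{\mathrm u,i}(t)+f(t),\qquad x_i(0)=x_0 .$$ Set $\kappa_*:=\max_{i=1,2}\|K_i\|_{\mathscr K_T(\mathcal{H}_{\mathrm r})}$. Then $$\|x_1-x_2\|_{\mathcal{C}([0,T];\mathcal{H}_{\mathrm r})}\le\sigma_T\exp(\sigma_T\kappa_*T)\Bigl[\|F_{\mathrm u,1}-F_{\mathrm u,2}\|_{L^1(0,T;\mathcal{H}_{\mathrm r})}+T\|K_1-K_2\|_{\mathscr K_T(\mathcal{H}_{\mathrm r})}\|x_2\|_{\mathcal{C}([0,T];\mathcal{H}_{\mathrm r})}\Bigr].$$ Consequently, suppose that a sequence of hidden realisations $(S_n,B_n,C_n,y_{0,n},g_n)$ and a hidden realisation $(S,B,C,y_0,g)$ on $[0,T]$ satisfy $$\max\Bigl\{\sup_n\sup_{0\le t\le T}\|S_n(t)\|,\ \sup_{0\le t\le T}\|S(t)\|\Bigr\}<\infty,\qquad\int_0^T\|S_n(t)-S(t)\|\,dt\to0,$$ $$\|B_n-B\|\to0,\qquad\|C_n-C\|\to0,\qquad\|y_{0,n}-y_0\|_{\mathcal{H}_{\mathrm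 u}}\to0,\qquad\|g_n-g\|_{L^1(0,T;\mathcal{H}_{\mathrm u})}\to0 .$$ Then the corresponding resolved trajectories $x_n$ (with the same $A$, $x_0$, $f$) converge in $\mathcal{C}([0,T];\mathcal{H}_{\mathrm r})$ to the resolved trajectory $x$ of $(S,B,C,y_0,g)$.
   Context: $\mathcal{H}_{\mathrm r}$ and $\mathcal{H}_{\mathrm u}$ are separable real Hilbert spaces; $T>0$ is an arbitrary fixed horizon; operator norms are written $\|\cdot\|$. $A$ generates a strongly continuous semigroup $S_A(t)$ on $\mathcal{H}_{\mathrm r}$ with $\|S_A(t)\|\le Me^{\omega t}$ for $t\ge0$, for some $M\ge1$, $\omega\in\mathbb{R}$; $\sigma_T:=Me^{\max\{\omega,0\}T}$. A hidden realisation on $[0,T]$ is a collection $(S,B,C,y_0,g)$ where $S(t)$ is a strongly continuous semigroup on $\mathcal{H}_{\mathrm u}$, $B:\mathcal{H}_{\mathrm u}\to\mathcal{H}_{\mathrm r}$ and $C:\mathcal{H}_{\mathrm r}\to\mathcal{H}_{\mathrm u}$ are bounded linear operators, $y_0\in\mathcal{H}_{\mathrm u}$ and $g\in L^1(0,T;\mathcal{H}_{\mathrm u})$; its induced pair is $K(t):=BS(t)C$ and $F_{\mathrm u}(t):=BS(t)y_0+B\int_0^tS(t-s)g(s)\,ds$. $\|K\|_{\mathscr K_T(\mathcal{H}_{\mathrm r})}:=\int_0^T\|K(t)\|\,dt$ and $(K*x)(t):=\int_0^tK(t-s)x(s)\,ds$. The resolved trajectory of a realisation, with resolved initial value $x_0$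 and forcing $f$, is the mild solution on $[0,T]$ of $x'=Ax+K*x+F_{\mathrm u}+f$, $x(0)=x_0$, i.e. the function $x\in\mathcal{C}([0,T];\mathcal{H}_{\mathrm r})$ with $x(t)=S_A(t)x_0+\int_0^tS_A(t-s)\{(K*x)(s)+F_{\mathrm u}(s)+f(s)\}\,ds$. *)

theory Defs
  imports "HOL-Analysis.Analysis"
begin

text \<open>
  Separable real Hilbert spaces are types of sort
  \<open>{real_inner, banach, second_countable_topology}\<close>: for metric spaces, separability and second
  countability coincide.  Only the values \<open>S t\<close> with \<open>t \<ge> 0\<close> of a semigroup
  \<open>S :: real \<Rightarrow> 'a \<Rightarrow>\<^sub>L 'a\<close> are relevant.
\<close>

definition C0_semigroup :: "(real \<Rightarrow> 'a::real_normed_vector \<Rightarrow>\<^sub>L 'a) \<Rightarrow> bool" where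
  "C0_semigroup S \<longleftrightarrow>
     S 0 = id_blinfun \<and>
     (\<forall>s\<ge>0. \<forall>t\<ge>0. S (s + t) = S s o\<^sub>L S t) \<and>
     (\<forall>x. continuous_on {0..} (\<lambda>t. blinfun_apply (S t) x))"

text \<open>The (unbounded) generator is represented by its graph.\<close>

definition generates :: "('a \<times> 'a) set \<Rightarrow> (real \<Rightarrow> 'a::real_normed_vector \<Rightarrow>\<^sub>L 'a) \<Rightarrow> bool" where
  "generates A S \<longleftrightarrow>
     C0_semigroup S \<and>
     A = {(x, y). ((\<lambda>h. (blinfun_apply (S h) x - x) /\<^sub>R h) \<longlongrightarrow> y) (at_right 0)}"

text \<open>
  Elements of \<open>L\<^sup>1(0,T;H)\<close> are given by Borel representatives.  The integral of the
  norm is also used for operator-valued kernels, where it is the integral of the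
  operator norm: for strongly continuous kernels on a separable space this scalar function
  is Borel measurable, although the kernel itself need not be measurable in operator norm.
\<close>

definition in_L1 :: "real \<Rightarrow> (real \<Rightarrow> 'a::{banach, second_countable_topology}) \<Rightarrow> bool" where
  "in_L1 T f \<longleftrightarrow> set_integrable lborel {0..T} f"

definition L1_norm :: "real \<Rightarrow> (real \<Rightarrow> 'a::real_normed_vector) \<Rightarrow> real" where
  "L1_norm T f = (LINT t:{0..T}|lborel. norm (f t))"

definition kernel_norm ::
    "real \<Rightarrow> (real \<Rightarrow> 'a::real_normed_vector \<Rightarrow>\<^sub>L 'b::real_normed_vector) \<Rightarrow> real" where
  "kernel_norm T K = (LINT t:{0..T}|lborel. norm (K t))"

definition C_norm :: "real \<Rightarrow> (real \<Rightarrow> 'a::real_normed_vector) \<Rightarrow> real" where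
  "C_norm T x = (SUP t\<in>{0..T}. norm (x t))"

definition conv ::
    "(real \<Rightarrow> 'a::real_normed_vector \<Rightarrow>\<^sub>L 'b::{banach, second_countable_topology})
      \<Rightarrow> (real \<Rightarrow> 'a) \<Rightarrow> real \<Rightarrow> 'b" where
  "conv K x t = (LINT s:{0..t}|lborel. blinfun_apply (K (t - s)) (x s))"

record (overloaded) ('r, 'u) realisation =
  semigroup_of :: "real \<Rightarrow> 'u::real_normed_vector \<Rightarrow>\<^sub>L 'u"
  B_of :: "'u \<Rightarrow>\<^sub>L 'r::real_normed_vector"
  C_of :: "'r \<Rightarrow>\<^sub>L 'u"
  init_of :: 'u
  force_of :: "real \<Rightarrow> 'u"

definition hidden_realisation ::
    "real \<Rightarrow> ('r::real_normed_vector, 'u::{banach, second_countable_topology}) realisation \<Rightarrow> bool" where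
  "hidden_realisation T R \<longleftrightarrow> C0_semigroup (semigroup_of R) \<and> in_L1 T (force_of R)"

definition induced_K ::
    "('r::real_normed_vector, 'u::real_normed_vector) realisation \<Rightarrow> real \<Rightarrow> 'r \<Rightarrow>\<^sub>L 'r" where
  "induced_K R t = B_of R o\<^sub>L semigroup_of R t o\<^sub>L C_of R"

definition induced_F ::
    "('r::real_normed_vector, 'u::{banach, second_countable_topology}) realisation \<Rightarrow> real \<Rightarrow> 'r" where
  "induced_F R t =
     blinfun_apply (B_of R) (blinfun_apply (semigroup_of R t) (init_of R)) +
     blinfun_apply (B_of R)
       (LINT s:{0..t}|lborel. blinfun_apply (semigroup_of R (t - s)) (force_of R s))"

text \<open>
  \<open>mild_solution S T x0 K F f x\<close>: \<open>x\<close> is a mild solution on \<open>[0,T]\<close> of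
  \<open>x' = A x + K * x + F + f\<close>, \<open>x(0) = x0\<close>, where \<open>A\<close> generates \<open>S\<close>.
  Values of \<open>x\<close> outside \<open>[0,T]\<close> are arbitrary.
\<close>

definition mild_solution ::
    "(real \<Rightarrow> 'r::{banach, second_countable_topology} \<Rightarrow>\<^sub>L 'r) \<Rightarrow> real \<Rightarrow> 'r
      \<Rightarrow> (real \<Rightarrow> 'r \<Rightarrow>\<^sub>L 'r) \<Rightarrow> (real \<Rightarrow> 'r) \<Rightarrow> (real \<Rightarrow> 'r) \<Rightarrow> (real \<Rightarrow> 'r) \<Rightarrow> bool" where
  "mild_solution S T x0 K F f x \<longleftrightarrow>
     continuous_on {0..T} x \<and>
     (\<forall>t\<in>{0..T}. x t = blinfun_apply (S t) x0 +
        (LINT s:{0..t}|lborel. blinfun_apply (S (t - s)) (conv K x s + F s + f s)))"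

definition resolved_trajectory ::
    "(real \<Rightarrow> 'r::{banach, second_countable_topology} \<Rightarrow>\<^sub>L 'r) \<Rightarrow> real \<Rightarrow> 'r \<Rightarrow> (real \<Rightarrow> 'r)
      \<Rightarrow> ('r, 'u::{banach, second_countable_topology}) realisation \<Rightarrow> (real \<Rightarrow> 'r) \<Rightarrow> bool" where
  "resolved_trajectory S T x0 f R x \<longleftrightarrow>
     mild_solution S T x0 (induced_K R) (induced_F R) f x"

definition growth_factor :: "real \<Rightarrow> real \<Rightarrow> real \<Rightarrow> real" where
  "growth_factor M \<omega> T = M * exp (max \<omega> 0 * T)"

end

theory Submission
  imports Defs
begin

text \<open>
  Subtracting the two mild equations, \<open>d = x\<^sub>1 - x\<^sub>2\<close> satisfies
  \<open>d = S\<^sub>A * (K\<^sub>1 * d + (K\<^sub>1 - K\<^sub>2) * x\<^sub>2 + F\<^sub>1 - F\<^sub>2)\<close>, and Gronwall's inequality applies.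
  For the convergence, the three-factor products \<open>B\<^sub>n S\<^sub>n C\<^sub>n\<close> and \<open>B\<^sub>n (S\<^sub>n y\<^sub>n + S\<^sub>n * g\<^sub>n)\<close>
  are telescoped, Young's inequality controls the term \<open>(S\<^sub>n - S) * g\<close>, and the
  stability estimate is applied with a uniform bound on the kernel norms.
  All kernels are only strongly continuous; this gives joint continuity of
  \<open>(t, x) \<mapsto> L t x\<close> and lower semicontinuity of \<open>t \<mapsto> norm (L t)\<close>, hence every
  measurability property needed.
\<close>

section \<open>Strongly continuous operator families on a compact interval\<close>

text \<open>Differences of semigroups and kernels of the form \<open>B S C\<close> are in general
  not semigroups. The estimates are therefore set in this class, which is stable under both
  operations.\<close>

definition strongly_continuous ::
    "real \<Rightarrow> (real \<Rightarrow> 'a::real_normed_vector \<Rightarrow>\<^sub>L 'b::real_normed_vector) \<Rightarrow> bool" where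
  "strongly_continuous T L \<longleftrightarrow> (\<forall>x. continuous_on {0..T} (\<lambda>t. blinfun_apply (L t) x))"

lemma strongly_continuous_diff:
  "strongly_continuous T L \<Longrightarrow> strongly_continuous T L' \<Longrightarrow>
    strongly_continuous T (\<lambda>t. L t - L' t)"
  unfolding strongly_continuous_def by (auto simp: blinfun.diff_left intro: continuous_intros)

lemma strongly_continuous_induced_K:
  "strongly_continuous T (semigroup_of R) \<Longrightarrow> strongly_continuous T (induced_K R)"
  unfolding strongly_continuous_def induced_K_def by (auto intro: continuous_intros)

lemma C0_semigroup_strongly_continuous: "C0_semigroup S \<Longrightarrow> strongly_continuous T S"
  unfolding C0_semigroup_def strongly_continuous_def
  by (meson atLeastAtMost_iff atLeast_iff continuous_on_subset subsetI)

text \<open>Uniform boundedness principle: by Baire, one of the closed sets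
  \<open>{x. \<forall>t. norm (L t x) \<le> n}\<close> contains a ball.\<close>

lemma strongly_continuous_bounded:
  fixes L :: "real \<Rightarrow> 'a::banach \<Rightarrow>\<^sub>L 'b::real_normed_vector"
  assumes "strongly_continuous T L"
  obtains N where "\<And>t. t \<in> {0..T} \<Longrightarrow> norm (L t) \<le> N"
proof -
  define F where "F n = {x. \<forall>t\<in>{0..T}. norm (L t x) \<le> real n}" for n
  have closed: "closed (F n)" for n
  proof -
    have "F n = (\<Inter>t\<in>{0..T}. {x. norm (L t x) \<le> real n})" by (auto simp: F_def)
    then show ?thesis by (auto intro!: closed_INT closed_Collect_le continuous_intros)
  qed
  have "(\<Union>n. F n) = UNIV"
  proof (intro set_eqI iffI UNIV_I)
    fix x
    have "compact ((\<lambda>t. L t x) ` {0..T})"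
      using assms by (auto simp: strongly_continuous_def intro: compact_continuous_image)
    then obtain b where b: "\<And>t. t \<in> {0..T} \<Longrightarrow> norm (L t x) \<le> b"
      by (fastforce dest!: compact_imp_bounded simp: bounded_iff)
    obtain n where "b \<le> real n" using real_arch_simple by blast
    then have "x \<in> F n" using b unfolding F_def by force
    then show "x \<in> (\<Union>n. F n)" by blast
  qed
  moreover have "interior (\<Union>(range F)) = {}" if "\<And>n. interior (F n) = {}"
    using Baire_category_alt[of "euclidean :: 'a topology" "range F"] closed that
    by (auto simp: completely_metrizable_space_euclidean)
  ultimately obtain n where "interior (F n) \<noteq> {}"
    by (metis interior_UNIV UNIV_not_empty)
  then obtain z r where r: "r > 0" and ball: "cball z r \<subseteq> F n"
    by (metis ex_in_conv mem_interior_cball)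
  \<comment> \<open>For a vector \<open>y\<close> of length \<open>r\<close>, \<open>L t y\<close>
    is the difference of the values at \<open>z + y\<close> and \<open>z\<close>, both in the ball,
    so its norm is at most \<open>2 * n\<close>. Rescaling from length \<open>r\<close> to
    \<open>norm x\<close> gives the constant.\<close>
  have "norm (L t) \<le> 2 * real n / r" if t: "t \<in> {0..T}" for t
  proof (rule norm_blinfun_bound)
    fix x
    show "norm (L t x) \<le> 2 * real n / r * norm x"
    proof (cases "x = 0")
      case False
      define y where "y = (r / norm x) *\<^sub>R x"
      have "z + y \<in> F n" "z \<in> F n"
        using ball r False by (auto simp: y_def dist_norm subset_iff)
      then have "norm (L t (z + y)) \<le> n" "norm (L t z) \<le> n"
        using t by (auto simp: F_def)
      then have "norm (L t y) \<le> 2 * n"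
        using norm_triangle_ineq4[of "L t (z + y)" "L t z"] by (simp add: blinfun.add_right)
      then show ?thesis
        using r False by (simp add: y_def blinfun.scaleR_right field_simps)
    qed simp
  qed (use r in simp)
  then show ?thesis by (rule that)
qed

section \<open>Joint continuity and measurability of evaluation\<close>

text \<open>The retraction of the line onto the interval. Precomposing a family with it gives a
  total function of time, so continuity and Borel measurability can be stated on the whole line
  whatever the family does outside the interval.\<close>

definition clamp_time :: "real \<Rightarrow> real \<Rightarrow> real" where
  "clamp_time T t = max 0 (min T t)"

lemma clamp_time_eq: "t \<in> {0..T} \<Longrightarrow> clamp_time T t = t"
  by (auto simp: clamp_time_def)

lemma clamp_time_mem: "0 \<le> T \<Longrightarrow> clamp_time T t \<in> {0..T}"
  by (auto simp: clamp_time_def)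

text \<open>Split \<open>L t x\<close> as \<open>L t y + L t (x - y)\<close>. The first term
  converges by strong continuity at the fixed vector \<open>y\<close>, the second vanishes because
  the operator norms are uniformly bounded.\<close>

lemma continuous_on_strongly_continuous:
  fixes L :: "real \<Rightarrow> 'a::banach \<Rightarrow>\<^sub>L 'b::real_normed_vector"
  assumes L: "strongly_continuous T L" and T: "0 \<le> T"
  shows "continuous_on UNIV (\<lambda>(t, x). blinfun_apply (L (clamp_time T t)) x)"
proof -
  obtain N where N: "\<And>t. t \<in> {0..T} \<Longrightarrow> norm (L t) \<le> N"
    using strongly_continuous_bounded[OF L] by blast
  have c: "continuous_on UNIV (\<lambda>t. L (clamp_time T t) x)" for x
    by (rule continuous_on_compose2[of "{0..T}" "\<lambda>t. L t x"])
      (use L T in \<open>auto simp: strongly_continuous_def clamp_time_def intro!: continuous_intros\<close>)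
  have "((\<lambda>(t, x). L (clamp_time T t) x) \<longlongrightarrow> L (clamp_time T s) y) (at (s, y))" for s y
  proof -
    have "((\<lambda>p. L (clamp_time T (fst p)) y) \<longlongrightarrow> L (clamp_time T s) y) (at (s, y))"
      using continuous_on_compose2[OF c[of y] continuous_on_fst[OF continuous_on_id], of UNIV]
      by (auto simp: continuous_on_def split: prod.splits)
    moreover have "((\<lambda>p. L (clamp_time T (fst p)) (snd p - y)) \<longlongrightarrow> 0) (at (s, y))"
    proof (rule Lim_null_comparison)
      show "\<forall>\<^sub>F p in at (s, y). norm (L (clamp_time T (fst p)) (snd p - y)) \<le> N * norm (snd p - y)"
        using N[OF clamp_time_mem[OF T]] norm_blinfun mult_right_mono[OF _ norm_ge_zero]
        by (intro always_eventually allI order_trans[OF norm_blinfun]) blast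
      show "((\<lambda>p. N * norm (snd p - y)) \<longlongrightarrow> 0) (at (s, y))"
        by (auto intro!: tendsto_eq_intros)
    qed
    ultimately have "((\<lambda>p. L (clamp_time T (fst p)) y + L (clamp_time T (fst p)) (snd p - y))
        \<longlongrightarrow> L (clamp_time T s) y + 0) (at (s, y))"
      by (rule tendsto_add)
    then show ?thesis
      by (simp add: blinfun.diff_right case_prod_beta')
  qed
  then show ?thesis by (auto simp: continuous_on_def)
qed

text \<open>The operator-valued map itself need not be measurable in operator norm. Composing the
  jointly continuous evaluation with a measurable pair of time and vector avoids that
  question.\<close>

lemma strongly_continuous_apply_measurable:
  fixes L :: "real \<Rightarrow> 'a::{banach, second_countable_topology} \<Rightarrow>\<^sub>L 'b::{real_normed_vector, second_countable_topology}"
  assumes "strongly_continuous T L" "0 \<le> T"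
    and "u \<in> borel_measurable M" "v \<in> borel_measurable M"
  shows "(\<lambda>p. blinfun_apply (L (clamp_time T (u p))) (v p)) \<in> borel_measurable M"
  using borel_measurable_continuous_Pair[OF assms(3,4), of "\<lambda>t x. L (clamp_time T t) x"]
    continuous_on_strongly_continuous[OF assms(1,2)]
  by (simp add: case_prod_beta)

text \<open>Sublevel sets of the operator norm are intersections of closed sets, so the norm of a
  strongly continuous function is lower semicontinuous.\<close>

lemma strongly_continuous_norm_measurable:
  fixes L :: "real \<Rightarrow> 'a::banach \<Rightarrow>\<^sub>L 'b::real_normed_vector"
  assumes L: "strongly_continuous T L" and T: "0 \<le> T"
  shows "(\<lambda>t. norm (L (clamp_time T t))) \<in> borel_measurable borel"
  unfolding borel_measurable_iff_le
proof
  fix a :: real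
  have "closed {t. norm (L (clamp_time T t)) \<le> a}"
  proof (cases "0 \<le> a")
    case True
    have c: "continuous_on UNIV (\<lambda>t. L (clamp_time T t) x)" for x
      using continuous_on_compose2[OF continuous_on_strongly_continuous[OF L T],
          of UNIV "\<lambda>t. (t, x)"] by (simp add: continuous_on_Pair)
    have "{t. norm (L (clamp_time T t)) \<le> a} = (\<Inter>x. {t. norm (L (clamp_time T t) x) \<le> a * norm x})"
      using True by (auto intro: norm_blinfun_bound order_trans[OF norm_blinfun mult_right_mono])
    also have "closed \<dots>"
      by (intro closed_INT ballI closed_Collect_le continuous_intros c)
    finally show ?thesis .
  next
    \<comment> \<open>The pointwise description is confined to \<open>0 \<le> a\<close>: on the
      trivial space its conditions would hold for negative \<open>a\<close> too, although the
      sublevel set is empty.\<close>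
    case False
    then have "{t. norm (L (clamp_time T t)) \<le> a} = {}"
      by (auto simp: not_le intro: less_le_trans)
    then show ?thesis by simp
  qed
  then show "{t \<in> space borel. norm (L (clamp_time T t)) \<le> a} \<in> sets borel"
    by simp
qed

text \<open>Semicontinuity supplies measurability, and uniform boundedness supplies a constant
  majorant on an interval of finite length.\<close>

lemma strongly_continuous_norm_integrable:
  fixes L :: "real \<Rightarrow> 'a::banach \<Rightarrow>\<^sub>L 'b::real_normed_vector"
  assumes L: "strongly_continuous T L"
  shows "set_integrable lborel {0..T} (\<lambda>t. norm (L t))"
proof (cases "0 \<le> T")
  case T: True
  obtain N where N: "\<And>t. t \<in> {0..T} \<Longrightarrow> norm (L t) \<le> N"
    using strongly_continuous_bounded[OF L] by blast
  have "set_integrable lborel {0..T} (\<lambda>t. norm (L (clamp_time T t)))"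
  proof (rule set_integrable_bound[of _ _ "\<lambda>_. N"])
    show "set_integrable lborel {0..T} (\<lambda>_. N)"
      by (intro borel_integrable_compact[folded set_integrable_def]) auto
    show "set_borel_measurable lborel {0..T} (\<lambda>t. norm (L (clamp_time T t)))"
      unfolding set_borel_measurable_def
      using strongly_continuous_norm_measurable[OF L T] by measurable
    show "AE t in lborel. t \<in> {0..T} \<longrightarrow> norm (norm (L (clamp_time T t))) \<le> norm N"
      using N by (auto simp: clamp_time_eq intro!: AE_I2 order_trans[OF _ abs_ge_self])
  qed
  then show ?thesis
    by (rule iffD1[OF set_integrable_cong[OF refl refl], rotated]) (simp add: clamp_time_eq)
qed simp

section \<open>Integrable functions on the interval\<close>

lemma in_L1_diff: "in_L1 T f \<Longrightarrow> in_L1 T g \<Longrightarrow> in_L1 T (\<lambda>t. f t - g t)"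
  unfolding in_L1_def by (rule set_integral_diff)

lemma in_L1_add: "in_L1 T f \<Longrightarrow> in_L1 T g \<Longrightarrow> in_L1 T (\<lambda>t. f t + g t)"
  unfolding in_L1_def by (rule set_integral_add)

lemma in_L1_blinfun:
  fixes B :: "'a::{banach, second_countable_topology} \<Rightarrow>\<^sub>L 'b::{banach, second_countable_topology}"
  shows "in_L1 T h \<Longrightarrow> in_L1 T (\<lambda>t. blinfun_apply B (h t))"
  unfolding in_L1_def set_integrable_def
  by (drule integrable_bounded_linear[OF blinfun.bounded_linear_right[of B]])
    (simp add: blinfun.scaleR_right)

lemma in_L1_norm: "in_L1 T h \<Longrightarrow> set_integrable lborel {0..T} (\<lambda>t. norm (h t))"
  unfolding in_L1_def by (rule set_integrable_norm)

text \<open>Integrability on a set constrains only the extension by zero, so this truncation is what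
  enters all later measurability arguments.\<close>

lemma in_L1_measurable: "in_L1 T h \<Longrightarrow> (\<lambda>s. indicator {0..T} s *\<^sub>R h s) \<in> borel_measurable borel"
  unfolding in_L1_def set_integrable_def by (drule borel_measurable_integrable) simp

lemma in_L1_continuous: "continuous_on {0..T} h \<Longrightarrow> in_L1 T h"
  unfolding in_L1_def set_integrable_def by (rule borel_integrable_compact) auto

text \<open>Two functions appear because a convolution is under control only for times in the
  interval: \<open>h'\<close> is a globally Borel function agreeing with it there.\<close>

lemma in_L1_bounded:
  fixes h :: "real \<Rightarrow> 'a::{banach, second_countable_topology}"
  assumes "h' \<in> borel_measurable borel" "\<And>t. t \<in> {0..T} \<Longrightarrow> h t = h' t"
    and "\<And>t. t \<in> {0..T} \<Longrightarrow> norm (h t) \<le> b"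
  shows "in_L1 T h"
proof -
  have "set_integrable lborel {0..T} h'"
  proof (rule set_integrable_bound[of _ _ "\<lambda>_. b"])
    show "set_integrable lborel {0..T} (\<lambda>_. b)"
      using in_L1_continuous[of T "\<lambda>_. b"] by (simp add: in_L1_def)
    show "set_borel_measurable lborel {0..T} h'"
      unfolding set_borel_measurable_def using assms(1) by measurable
    show "AE t in lborel. t \<in> {0..T} \<longrightarrow> norm (h' t) \<le> norm b"
      using assms(2,3) by (auto intro!: AE_I2 order_trans[OF _ abs_ge_self])
  qed
  then show ?thesis
    using assms(2) unfolding in_L1_def
    by (subst set_integrable_cong[OF refl refl]) auto
qed

lemma set_lebesgue_integral_nonneg:
  fixes f :: "real \<Rightarrow> real"
  shows "(\<And>t. t \<in> A \<Longrightarrow> 0 \<le> f t) \<Longrightarrow> 0 \<le> (LINT t:A|M. f t)"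
  unfolding set_lebesgue_integral_def by (intro integral_nonneg_AE AE_I2) (auto simp: indicator_def)

lemma set_integral_mono_set:
  fixes f :: "real \<Rightarrow> real"
  assumes "set_integrable lborel {0..T} f" "\<And>s. 0 \<le> f s" "t \<le> T"
  shows "(LINT s:{0..t}|lborel. f s) \<le> (LINT s:{0..T}|lborel. f s)"
  using set_integrable_subset[OF assms(1), of "{0..t}"] assms
  unfolding set_lebesgue_integral_def set_integrable_def
  by (intro integral_mono) (auto simp: indicator_def)

lemma L1_norm_nonneg: "0 \<le> L1_norm T h"
  unfolding L1_norm_def by (rule set_lebesgue_integral_nonneg) simp

lemma kernel_norm_nonneg: "0 \<le> kernel_norm T L"
  unfolding kernel_norm_def by (rule set_lebesgue_integral_nonneg) simp

section \<open>Convolution with strongly continuous kernels\<close>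

text \<open>The integrand is dominated by \<open>N * norm (h s)\<close> with \<open>N\<close> from
  uniform boundedness. Linearity of the convolution in either factor rests on this.\<close>

lemma conv_integrable:
  fixes L :: "real \<Rightarrow> 'a::{banach, second_countable_topology} \<Rightarrow>\<^sub>L 'b::{banach, second_countable_topology}"
  assumes L: "strongly_continuous T L" and h: "in_L1 T h" and t: "t \<in> {0..T}"
  shows "set_integrable lborel {0..t} (\<lambda>s. blinfun_apply (L (t - s)) (h s))"
proof -
  obtain N where N: "\<And>t. t \<in> {0..T} \<Longrightarrow> norm (L t) \<le> N"
    using strongly_continuous_bounded[OF L] by blast
  have N0: "0 \<le> N" using N[of t] t norm_ge_zero order_trans by blast
  \<comment> \<open>Clamping the time and truncating \<open>h\<close> makes the integrand globally
    Borel. For \<open>s\<close> in \<open>{0..t}\<close> neither changes anything, since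
    \<open>s\<close> and \<open>t - s\<close> both lie in \<open>{0..T}\<close>.\<close>
  have meas: "(\<lambda>s. L (clamp_time T (t - s)) (indicator {0..T} s *\<^sub>R h s)) \<in> borel_measurable borel"
    using t in_L1_measurable[OF h] by (intro strongly_continuous_apply_measurable[OF L]) auto
  show ?thesis
  proof (rule set_integrable_bound[of _ _ "\<lambda>s. N * norm (h s)"])
    show "set_integrable lborel {0..t} (\<lambda>s. N * norm (h s))"
      using t by (intro set_integrable_mult_right set_integrable_subset[OF in_L1_norm[OF h]]) auto
    have "(\<lambda>s. indicator {0..t} s *\<^sub>R L (clamp_time T (t - s)) (indicator {0..T} s *\<^sub>R h s))
        \<in> borel_measurable lborel"
      using meas by measurable
    also have "(\<lambda>s. indicator {0..t} s *\<^sub>R L (clamp_time T (t - s)) (indicator {0..T} s *\<^sub>R h s))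
        = (\<lambda>s. indicator {0..t} s *\<^sub>R L (t - s) (h s))"
      using t by (auto simp: fun_eq_iff indicator_def clamp_time_eq)
    finally show "set_borel_measurable lborel {0..t} (\<lambda>s. L (t - s) (h s))"
      unfolding set_borel_measurable_def .
    show "AE s in lborel. s \<in> {0..t} \<longrightarrow> norm (L (t - s) (h s)) \<le> norm (N * norm (h s))"
    proof (intro AE_I2 impI)
      fix s assume "s \<in> {0..t}"
      then have "norm (L (t - s) (h s)) \<le> N * norm (h s)"
        using t by (intro order_trans[OF norm_blinfun] mult_right_mono N) auto
      then show "norm (L (t - s) (h s)) \<le> norm (N * norm (h s))"
        using N0 by simp
    qed
  qed
qed

lemma conv_diff_right:
  fixes L :: "real \<Rightarrow> 'a::{banach, second_countable_topology} \<Rightarrow>\<^sub>L 'b::{banach, second_countable_topology}"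
  assumes "strongly_continuous T L" "in_L1 T h" "in_L1 T h'" "t \<in> {0..T}"
  shows "conv L (\<lambda>s. h s - h' s) t = conv L h t - conv L h' t"
  unfolding conv_def using assms
  by (simp add: blinfun.diff_right set_integral_diff conv_integrable)

lemma conv_diff_left:
  fixes L :: "real \<Rightarrow> 'a::{banach, second_countable_topology} \<Rightarrow>\<^sub>L 'b::{banach, second_countable_topology}"
  assumes "strongly_continuous T L" "strongly_continuous T L'" "in_L1 T h" "t \<in> {0..T}"
  shows "conv (\<lambda>t. L t - L' t) h t = conv L h t - conv L' h t"
  unfolding conv_def using assms
  by (simp add: blinfun.diff_left set_integral_diff conv_integrable)

text \<open>The integral stops at \<open>t\<close> rather than \<open>T\<close>; the Gronwall
  argument needs this dependence on the current time.\<close>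

lemma norm_conv_le:
  fixes L :: "real \<Rightarrow> 'a::{banach, second_countable_topology} \<Rightarrow>\<^sub>L 'b::{banach, second_countable_topology}"
  assumes L: "strongly_continuous T L" and h: "in_L1 T h" and t: "t \<in> {0..T}"
    and N: "\<And>t. t \<in> {0..T} \<Longrightarrow> norm (L t) \<le> N"
  shows "norm (conv L h t) \<le> N * (LINT s:{0..t}|lborel. norm (h s))"
proof -
  have "norm (conv L h t) \<le> (LINT s:{0..t}|lborel. norm (L (t - s) (h s)))"
    unfolding conv_def by (intro set_integral_norm_bound conv_integrable[OF L h t])
  also have "\<dots> \<le> (LINT s:{0..t}|lborel. N * norm (h s))"
  proof (rule set_integral_mono)
    show "set_integrable lborel {0..t} (\<lambda>s. N * norm (h s))"
      using t by (intro set_integrable_mult_right set_integrable_subset[OF in_L1_norm[OF h]]) auto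
    show "norm (L (t - s) (h s)) \<le> N * norm (h s)" if "s \<in> {0..t}" for s
      using that t by (intro order_trans[OF norm_blinfun] mult_right_mono N) auto
  qed (intro set_integrable_norm conv_integrable[OF L h t])
  finally show ?thesis by simp
qed

lemma norm_conv_le_L1_norm:
  fixes L :: "real \<Rightarrow> 'a::{banach, second_countable_topology} \<Rightarrow>\<^sub>L 'b::{banach, second_countable_topology}"
  assumes L: "strongly_continuous T L" and h: "in_L1 T h" and t: "t \<in> {0..T}"
    and N: "\<And>t. t \<in> {0..T} \<Longrightarrow> norm (L t) \<le> N"
  shows "norm (conv L h t) \<le> N * L1_norm T h"
proof -
  have "N * (LINT s:{0..t}|lborel. norm (h s)) \<le> N * L1_norm T h"
    unfolding L1_norm_def using t order_trans[OF norm_ge_zero N[OF t]]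
    by (intro mult_left_mono set_integral_mono_set in_L1_norm[OF h]) auto
  then show ?thesis using norm_conv_le[OF assms] by (rule order_trans[rotated])
qed

text \<open>The counterpart of \<open>norm_conv_le\<close> with the kernel integrated and the
  function bounded. The bound \<open>c\<close> is required only up to time \<open>t\<close>, so it
  may itself grow with \<open>t\<close>.\<close>

lemma norm_conv_le_kernel_norm:
  fixes L :: "real \<Rightarrow> 'a::{banach, second_countable_topology} \<Rightarrow>\<^sub>L 'b::{banach, second_countable_topology}"
  assumes L: "strongly_continuous T L" and h: "in_L1 T h" and t: "t \<in> {0..T}"
    and c: "\<And>s. s \<in> {0..t} \<Longrightarrow> norm (h s) \<le> c"
  shows "norm (conv L h t) \<le> kernel_norm T L * c"
proof -
  have c0: "0 \<le> c" using order_trans[OF norm_ge_zero c[of t]] t by simp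
  have int: "set_integrable lborel {0..t} (\<lambda>s. norm (L s))"
    using t by (intro set_integrable_subset[OF strongly_continuous_norm_integrable[OF L]]) auto
  \<comment> \<open>The reflection \<open>s \<mapsto> t - s\<close> maps \<open>{0..t}\<close> onto
    itself and preserves Lebesgue measure, so the reversed kernel has the same integral.\<close>
  have ind: "indicat_real {0..t} (t - s) = indicat_real {0..t} s" for s
    by (auto simp: indicator_def)
  have int': "set_integrable lborel {0..t} (\<lambda>s. norm (L (t - s)))"
    using lborel_integrable_real_affine[OF int[unfolded set_integrable_def], of "-1" t]
    by (simp add: set_integrable_def ind)
  have eq: "(LINT s:{0..t}|lborel. norm (L (t - s))) = (LINT s:{0..t}|lborel. norm (L s))"
    using lborel_integral_real_affine[of "-1" "\<lambda>s. indicator {0..t} s * norm (L s)" t]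
    by (simp add: set_lebesgue_integral_def ind)
  have "norm (conv L h t) \<le> (LINT s:{0..t}|lborel. norm (L (t - s) (h s)))"
    unfolding conv_def by (intro set_integral_norm_bound conv_integrable[OF L h t])
  also have "\<dots> \<le> (LINT s:{0..t}|lborel. norm (L (t - s)) * c)"
    by (intro set_integral_mono set_integrable_norm conv_integrable[OF L h t]
        set_integrable_mult_left int' order_trans[OF norm_blinfun] mult_left_mono c norm_ge_zero)
  also have "\<dots> = (LINT s:{0..t}|lborel. norm (L s)) * c"
    by (simp add: eq)
  also have "\<dots> \<le> kernel_norm T L * c"
    unfolding kernel_norm_def using t c0
    by (intro mult_right_mono set_integral_mono_set strongly_continuous_norm_integrable L) auto
  finally show ?thesis .
qed

text \<open>Measurability in \<open>t\<close> comes from measurability of parameter integrals of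
  jointly measurable functions, and integrability from a uniform bound.\<close>

lemma in_L1_conv:
  fixes L :: "real \<Rightarrow> 'a::{banach, second_countable_topology} \<Rightarrow>\<^sub>L 'b::{banach, second_countable_topology}"
  assumes L: "strongly_continuous T L" and h: "in_L1 T h"
  shows "in_L1 T (conv L h)"
proof (cases "0 \<le> T")
  case T: True
  obtain N where N: "\<And>t. t \<in> {0..T} \<Longrightarrow> norm (L t) \<le> N"
    using strongly_continuous_bounded[OF L] by blast
  \<comment> \<open>The integrand extended by zero outside the triangle
    \<open>0 \<le> s \<le> t\<close>, which moves the variable endpoint into the integrand.\<close>
  define \<phi> where "\<phi> t s = (if 0 \<le> s \<and> s \<le> t
      then L (clamp_time T (t - s)) (indicator {0..T} s *\<^sub>R h s) else 0)" for t s
  have [measurable]: "(\<lambda>p. L (clamp_time T (fst p - snd p)) (indicator {0..T} (snd p) *\<^sub>R h (snd p)))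
      \<in> borel_measurable (borel \<Otimes>\<^sub>M lborel)"
  proof (rule strongly_continuous_apply_measurable[OF L T])
    show "(\<lambda>p. indicator {0..T} (snd p) *\<^sub>R h (snd p)) \<in> borel_measurable (borel \<Otimes>\<^sub>M lborel)"
      by (rule measurable_compose[OF measurable_snd]) (simp add: in_L1_measurable[OF h])
  qed measurable
  have "case_prod \<phi> \<in> borel_measurable (borel \<Otimes>\<^sub>M lborel)"
    unfolding \<phi>_def case_prod_beta by measurable
  then have "(\<lambda>t. \<integral>s. \<phi> t s \<partial>lborel) \<in> borel_measurable borel"
    by (rule lborel.borel_measurable_lebesgue_integral)
  then show ?thesis
  proof (rule in_L1_bounded)
    show "conv L h t = (\<integral>s. \<phi> t s \<partial>lborel)" if "t \<in> {0..T}" for t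
      unfolding conv_def set_lebesgue_integral_def using that
      by (intro Bochner_Integration.integral_cong) (auto simp: \<phi>_def indicator_def clamp_time_eq)
    show "norm (conv L h t) \<le> N * L1_norm T h" if "t \<in> {0..T}" for t
      by (rule norm_conv_le_L1_norm[OF L h that N])
  qed
qed (simp add: in_L1_def)

text \<open>Young's inequality, by Tonelli and translation invariance after extending both
  factors by zero.\<close>

lemma L1_norm_conv_le:
  fixes L :: "real \<Rightarrow> 'a::{banach, second_countable_topology} \<Rightarrow>\<^sub>L 'b::{banach, second_countable_topology}"
  assumes L: "strongly_continuous T L" and h: "in_L1 T h" and T: "0 \<le> T"
  shows "L1_norm T (conv L h) \<le> kernel_norm T L * L1_norm T h"
proof -
  define a where "a r = ennreal (indicator {0..T} r * norm (L (clamp_time T r)))" for r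
  define b where "b s = ennreal (norm (indicator {0..T} s *\<^sub>R h s))" for s
  have [measurable]: "a \<in> borel_measurable borel" "b \<in> borel_measurable borel"
    unfolding a_def b_def
    using strongly_continuous_norm_measurable[OF L T] in_L1_measurable[OF h] by measurable
  have a_int: "(\<integral>\<^sup>+r. a r \<partial>lborel) = ennreal (kernel_norm T L)"
  proof -
    have "a = (\<lambda>r. ennreal (indicator {0..T} r *\<^sub>R norm (L r)))"
      by (auto simp: a_def indicator_def clamp_time_eq)
    then show ?thesis
      using strongly_continuous_norm_integrable[OF L]
      unfolding kernel_norm_def set_integrable_def set_lebesgue_integral_def
      by (simp add: nn_integral_eq_integral)
  qed
  have b_int: "(\<integral>\<^sup>+s. b s \<partial>lborel) = ennreal (L1_norm T h)"
    using in_L1_norm[OF h]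
    unfolding b_def L1_norm_def set_integrable_def set_lebesgue_integral_def
    by (simp add: nn_integral_eq_integral)
  \<comment> \<open>Integrability of the convolution identifies its norm with a nonnegative
    integral, where Tonelli asks for measurability alone.\<close>
  have "ennreal (L1_norm T (conv L h)) = (\<integral>\<^sup>+t. ennreal (indicator {0..T} t * norm (conv L h t)) \<partial>lborel)"
    using in_L1_norm[OF in_L1_conv[OF L h]]
    unfolding L1_norm_def set_integrable_def set_lebesgue_integral_def
    by (simp add: nn_integral_eq_integral)
  also have "\<dots> \<le> (\<integral>\<^sup>+t. \<integral>\<^sup>+s. a (t - s) * b s \<partial>lborel \<partial>lborel)"
  proof (rule nn_integral_mono)
    fix t :: real
    show "ennreal (indicator {0..T} t * norm (conv L h t)) \<le> (\<integral>\<^sup>+s. a (t - s) * b s \<partial>lborel)"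
    proof (cases "t \<in> {0..T}")
      case t: True
      have "ennreal (norm (conv L h t))
          \<le> (\<integral>\<^sup>+s. ennreal (norm (indicator {0..t} s *\<^sub>R L (t - s) (h s))) \<partial>lborel)"
        using conv_integrable[OF L h t] unfolding conv_def set_lebesgue_integral_def set_integrable_def
        by (rule integral_norm_bound_ennreal)
      also have "\<dots> \<le> (\<integral>\<^sup>+s. a (t - s) * b s \<partial>lborel)"
      proof (rule nn_integral_mono)
        fix s
        show "ennreal (norm (indicator {0..t} s *\<^sub>R L (t - s) (h s))) \<le> a (t - s) * b s"
        proof (cases "s \<in> {0..t}")
          case True
          then have "a (t - s) * b s = ennreal (norm (L (t - s)) * norm (h s))"
            using t by (simp add: a_def b_def clamp_time_eq ennreal_mult)
          then show ?thesis
            using True by (simp add: norm_blinfun)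
        qed simp
      qed
      finally show ?thesis using t by simp
    qed simp
  qed
  also have "\<dots> = (\<integral>\<^sup>+s. \<integral>\<^sup>+t. a (t - s) * b s \<partial>lborel \<partial>lborel)"
    by (rule lborel_pair.Fubini'[symmetric]) measurable
  also have "\<dots> = (\<integral>\<^sup>+s. (\<integral>\<^sup>+r. a r \<partial>lborel) * b s \<partial>lborel)"
  proof (rule nn_integral_cong)
    fix s
    have "(\<integral>\<^sup>+t. a (t - s) \<partial>lborel) = (\<integral>\<^sup>+r. a r \<partial>lborel)"
      using nn_integral_real_affine[of a 1 "- s"] by simp
    then show "(\<integral>\<^sup>+t. a (t - s) * b s \<partial>lborel) = (\<integral>\<^sup>+r. a r \<partial>lborel) * b s"
      by (simp add: nn_integral_multc)
  qed
  also have "\<dots> = ennreal (kernel_norm T L * L1_norm T h)"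
    by (simp add: nn_integral_cmult a_int b_int ennreal_mult kernel_norm_nonneg L1_norm_nonneg)
  finally show ?thesis
    by (simp add: kernel_norm_nonneg L1_norm_nonneg)
qed

section \<open>Supremum norm and exponentially weighted Gronwall inequality\<close>

lemma C_norm_le: "0 \<le> T \<Longrightarrow> (\<And>t. t \<in> {0..T} \<Longrightarrow> norm (x t) \<le> b) \<Longrightarrow> C_norm T x \<le> b"
  unfolding C_norm_def by (rule cSUP_least) auto

text \<open>A real supremum dominates the members only of a set bounded above; compactness of the
  interval provides this.\<close>

lemma norm_le_C_norm:
  assumes "continuous_on {0..T} x" "t \<in> {0..T}"
  shows "norm (x t) \<le> C_norm T x"
proof -
  have "compact ((\<lambda>t. norm (x t)) ` {0..T})"
    using assms(1) by (intro compact_continuous_image continuous_intros) auto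
  then show ?thesis
    unfolding C_norm_def using assms(2)
    by (intro cSUP_upper bounded_imp_bdd_above compact_imp_bounded)
qed

text \<open>Take \<open>m\<close> to be the maximum of \<open>d t * exp (- l * t)\<close>: the hypothesis at the maximum
  point gives \<open>m \<le> a\<close>, with no passage to the running supremum of \<open>d\<close>.\<close>

lemma weighted_gronwall:
  fixes d :: "real \<Rightarrow> real"
  assumes d: "continuous_on {0..T} d" and a: "0 \<le> a" and l: "0 \<le> l" and t: "t \<in> {0..T}"
    and step: "\<And>t m. t \<in> {0..T} \<Longrightarrow> (\<And>s. s \<in> {0..t} \<Longrightarrow> d s \<le> m * exp (l * s)) \<Longrightarrow>
      d t \<le> a + m * (exp (l * t) - 1)"
  shows "d t \<le> a * exp (l * T)"
proof -
  have "continuous_on {0..T} (\<lambda>s. d s * exp (- l * s))"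
    by (intro continuous_intros d)
  then obtain r where r: "r \<in> {0..T}"
    and max: "\<And>s. s \<in> {0..T} \<Longrightarrow> d s * exp (- l * s) \<le> d r * exp (- l * r)"
    using continuous_attains_sup[of "{0..T}" "\<lambda>s. d s * exp (- l * s)"] t by fastforce
  define m where "m = d r * exp (- l * r)"
  have le: "d s \<le> m * exp (l * s)" if "s \<in> {0..T}" for s
    using max[OF that] by (simp add: m_def exp_minus field_simps)
  have "d r \<le> a + m * (exp (l * r) - 1)"
    using r by (intro step le) auto
  moreover have "d r = m * exp (l * r)"
    by (simp add: m_def exp_minus)
  ultimately have "m \<le> a" by (simp add: algebra_simps)
  have "d t \<le> m * exp (l * t)" by (rule le[OF t])
  also have "\<dots> \<le> a * exp (l * t)" using \<open>m \<le> a\<close> by simp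
  also have "\<dots> \<le> a * exp (l * T)" using a l t by (simp add: mult_left_mono)
  finally show ?thesis .
qed

text \<open>This accounts for the term \<open>exp (l * t) - 1\<close> in
  \<open>weighted_gronwall\<close>. Keeping the factor \<open>l\<close> on the left covers
  \<open>l = 0\<close> without division.\<close>

lemma mult_integral_exp:
  fixes l t :: real
  assumes "0 \<le> t"
  shows "l * (LINT s:{0..t}|lborel. exp (l * s)) = exp (l * t) - 1"
proof -
  have "(LINT s:{0..t}|lborel. l * exp (l * s)) = exp (l * t) - exp (l * 0)"
    unfolding set_lebesgue_integral_def
  proof (rule integral_FTC_Icc[OF assms])
    show "((\<lambda>s. exp (l * s)) has_vector_derivative l * exp (l * s)) (at s within {0..t})" for s
      by (auto intro!: derivative_eq_intros simp flip: has_real_derivative_iff_has_vector_derivative)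
  qed (intro continuous_intros)
  then show ?thesis by simp
qed

section \<open>Stability of mild solutions\<close>

text \<open>Pairing \<open>K\<^sub>1\<close> with the difference of the solutions and
  \<open>K\<^sub>1 - K\<^sub>2\<close> with \<open>x\<^sub>2\<close> puts only the first kernel into
  the exponent. Any upper bound \<open>\<kappa>\<close> is allowed, so it can be the maximum of two
  kernel norms or a bound uniform along a sequence.\<close>

lemma mild_solution_stability:
  fixes S :: "real \<Rightarrow> 'r::{banach, second_countable_topology} \<Rightarrow>\<^sub>L 'r"
  assumes T: "0 \<le> T" and S: "strongly_continuous T S"
    and \<sigma>: "\<And>t. t \<in> {0..T} \<Longrightarrow> norm (S t) \<le> \<sigma>"
    and K: "strongly_continuous T K\<^sub>1" "strongly_continuous T K\<^sub>2"
    and F: "in_L1 T F\<^sub>1" "in_L1 T F\<^sub>2" and f: "in_L1 T f"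
    and sol: "mild_solution S T x0 K\<^sub>1 F\<^sub>1 f x\<^sub>1" "mild_solution S T x0 K\<^sub>2 F\<^sub>2 f x\<^sub>2"
    and \<kappa>: "kernel_norm T K\<^sub>1 \<le> \<kappa>"
  shows "C_norm T (\<lambda>t. x\<^sub>1 t - x\<^sub>2 t) \<le> \<sigma> * exp (\<sigma> * \<kappa> * T) *
    (L1_norm T (\<lambda>t. F\<^sub>1 t - F\<^sub>2 t) + T * kernel_norm T (\<lambda>t. K\<^sub>1 t - K\<^sub>2 t) * C_norm T x\<^sub>2)"
proof (rule C_norm_le[OF T])
  fix t assume t: "t \<in> {0..T}"
  define k where "k = kernel_norm T (\<lambda>t. K\<^sub>1 t - K\<^sub>2 t) * C_norm T x\<^sub>2"
  define a where "a = \<sigma> * (L1_norm T (\<lambda>t. F\<^sub>1 t - F\<^sub>2 t) + T * k)"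
  have \<sigma>0: "0 \<le> \<sigma>" by (rule order_trans[OF norm_ge_zero \<sigma>[OF t]])
  have \<kappa>0: "0 \<le> \<kappa>" by (rule order_trans[OF kernel_norm_nonneg \<kappa>])
  have x: "continuous_on {0..T} x\<^sub>1" "continuous_on {0..T} x\<^sub>2"
    using sol by (auto simp: mild_solution_def)
  have c0: "0 \<le> C_norm T x\<^sub>2"
    using norm_le_C_norm[OF x(2) t] norm_ge_zero order_trans by blast
  have k0: "0 \<le> k" unfolding k_def by (intro mult_nonneg_nonneg kernel_norm_nonneg c0)
  have xL: "in_L1 T x\<^sub>1" "in_L1 T x\<^sub>2" "in_L1 T (\<lambda>t. x\<^sub>1 t - x\<^sub>2 t)"
    using x by (auto intro: in_L1_continuous in_L1_diff)
  have FL: "in_L1 T (\<lambda>t. F\<^sub>1 t - F\<^sub>2 t)" by (rule in_L1_diff[OF F])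
  define h where "h s = (conv K\<^sub>1 x\<^sub>1 s + F\<^sub>1 s + f s) - (conv K\<^sub>2 x\<^sub>2 s + F\<^sub>2 s + f s)" for s
  have hL: "in_L1 T (\<lambda>s. conv K\<^sub>1 x\<^sub>1 s + F\<^sub>1 s + f s)" "in_L1 T (\<lambda>s. conv K\<^sub>2 x\<^sub>2 s + F\<^sub>2 s + f s)"
    by (intro in_L1_add in_L1_conv K xL F f)+
  then have hL': "in_L1 T h" unfolding h_def by (rule in_L1_diff)
  \<comment> \<open>The terms with \<open>x0\<close> cancel, and linearity merges the two integrals
    into one convolution.\<close>
  have diff: "x\<^sub>1 t - x\<^sub>2 t = conv S h t" if "t \<in> {0..T}" for t
    using sol that conv_diff_right[OF S hL that]
    unfolding mild_solution_def h_def by (simp add: conv_def)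
  have h: "h s = conv K\<^sub>1 (\<lambda>s. x\<^sub>1 s - x\<^sub>2 s) s + conv (\<lambda>t. K\<^sub>1 t - K\<^sub>2 t) x\<^sub>2 s + (F\<^sub>1 s - F\<^sub>2 s)"
    if "s \<in> {0..T}" for s
    using that by (simp add: h_def conv_diff_right[OF K(1)] conv_diff_left[OF K] xL)
  have "norm (x\<^sub>1 t - x\<^sub>2 t) \<le> a * exp (\<sigma> * \<kappa> * T)"
  proof (rule weighted_gronwall[OF _ _ _ t])
    show "continuous_on {0..T} (\<lambda>t. norm (x\<^sub>1 t - x\<^sub>2 t))" by (intro continuous_intros x)
    show "0 \<le> a" unfolding a_def by (intro mult_nonneg_nonneg add_nonneg_nonneg \<sigma>0 L1_norm_nonneg T k0)
    show "0 \<le> \<sigma> * \<kappa>" by (intro mult_nonneg_nonneg \<sigma>0 \<kappa>0)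
    fix t m
    assume t: "t \<in> {0..T}" and m: "\<And>s. s \<in> {0..t} \<Longrightarrow> norm (x\<^sub>1 s - x\<^sub>2 s) \<le> m * exp (\<sigma> * \<kappa> * s)"
    have m0: "0 \<le> m" using order_trans[OF norm_ge_zero m[of 0]] t by simp
    have hb: "norm (h s) \<le> \<kappa> * m * exp (\<sigma> * \<kappa> * s) + k + norm (F\<^sub>1 s - F\<^sub>2 s)" if s: "s \<in> {0..t}" for s
    proof -
      have sT: "s \<in> {0..T}" using s t by auto
      have "norm (conv K\<^sub>1 (\<lambda>s. x\<^sub>1 s - x\<^sub>2 s) s) \<le> kernel_norm T K\<^sub>1 * (m * exp (\<sigma> * \<kappa> * s))"
      proof (rule norm_conv_le_kernel_norm[OF K(1) xL(3) sT])
        fix r assume r: "r \<in> {0..s}"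
        then have "norm (x\<^sub>1 r - x\<^sub>2 r) \<le> m * exp (\<sigma> * \<kappa> * r)" using s by (intro m) auto
        \<comment> \<open>The majorant is nondecreasing, so its value at \<open>s\<close> serves as
          the constant for all earlier times.\<close>
        also have "\<dots> \<le> m * exp (\<sigma> * \<kappa> * s)"
          using r m0 \<sigma>0 \<kappa>0 by (simp add: mult_left_mono)
        finally show "norm (x\<^sub>1 r - x\<^sub>2 r) \<le> m * exp (\<sigma> * \<kappa> * s)" .
      qed
      also have "\<dots> \<le> \<kappa> * (m * exp (\<sigma> * \<kappa> * s))"
        using m0 by (intro mult_right_mono \<kappa>) simp
      finally have 1: "norm (conv K\<^sub>1 (\<lambda>s. x\<^sub>1 s - x\<^sub>2 s) s) \<le> \<kappa> * m * exp (\<sigma> * \<kappa> * s)"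
        by (simp add: mult.assoc)
      have 2: "norm (conv (\<lambda>t. K\<^sub>1 t - K\<^sub>2 t) x\<^sub>2 s) \<le> k"
        unfolding k_def using sT
        by (intro norm_conv_le_kernel_norm strongly_continuous_diff K xL norm_le_C_norm x) auto
      show ?thesis
        unfolding h[OF sT] by (intro norm_triangle_le add_mono 1 2 order_refl)
    qed
    have Ft: "set_integrable lborel {0..t} (\<lambda>s. norm (F\<^sub>1 s - F\<^sub>2 s))"
      using t by (intro set_integrable_subset[OF in_L1_norm[OF FL]]) auto
    have exp_int: "set_integrable lborel {0..t} (\<lambda>s. exp (\<sigma> * \<kappa> * s))"
      using in_L1_continuous[of t "\<lambda>s. exp (\<sigma> * \<kappa> * s)"]
      by (simp add: in_L1_def continuous_intros)
    have k_int: "set_integrable lborel {0..t} (\<lambda>_. k)"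
      using in_L1_continuous[of t "\<lambda>_. k"] by (simp add: in_L1_def)
    have int1: "set_integrable lborel {0..t} (\<lambda>s. \<kappa> * m * exp (\<sigma> * \<kappa> * s) + k)"
      by (intro set_integral_add set_integrable_mult_right exp_int k_int)
    have "norm (x\<^sub>1 t - x\<^sub>2 t) \<le> \<sigma> * (LINT s:{0..t}|lborel. norm (h s))"
      unfolding diff[OF t] by (rule norm_conv_le[OF S hL' t \<sigma>])
    also have "\<dots> \<le> \<sigma> * (LINT s:{0..t}|lborel. \<kappa> * m * exp (\<sigma> * \<kappa> * s) + k + norm (F\<^sub>1 s - F\<^sub>2 s))"
      using t by (intro mult_left_mono \<sigma>0 set_integral_mono hb set_integral_add int1 Ft
          set_integrable_subset[OF in_L1_norm[OF hL']]) auto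
    also have "(LINT s:{0..t}|lborel. \<kappa> * m * exp (\<sigma> * \<kappa> * s) + k + norm (F\<^sub>1 s - F\<^sub>2 s))
        = \<kappa> * m * (LINT s:{0..t}|lborel. exp (\<sigma> * \<kappa> * s)) + t * k
          + (LINT s:{0..t}|lborel. norm (F\<^sub>1 s - F\<^sub>2 s))"
      using t by (simp add: set_integral_add int1 Ft k_int exp_int set_integrable_mult_right
          set_integral_const)
    \<comment> \<open>The rate \<open>\<sigma> * \<kappa>\<close> is collected in front of the
      exponential integral, ready for \<open>mult_integral_exp\<close>.\<close>
    also have "\<sigma> * \<dots> = m * (\<sigma> * \<kappa> * (LINT s:{0..t}|lborel. exp (\<sigma> * \<kappa> * s)))
        + \<sigma> * (t * k + (LINT s:{0..t}|lborel. norm (F\<^sub>1 s - F\<^sub>2 s)))"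
      by (simp add: algebra_simps)
    also have "\<sigma> * \<kappa> * (LINT s:{0..t}|lborel. exp (\<sigma> * \<kappa> * s)) = exp (\<sigma> * \<kappa> * t) - 1"
      using t by (intro mult_integral_exp) simp
    \<comment> \<open>Enlarging \<open>t\<close> to \<open>T\<close> in both source terms makes the
      remainder independent of time.\<close>
    also have "\<sigma> * (t * k + (LINT s:{0..t}|lborel. norm (F\<^sub>1 s - F\<^sub>2 s))) \<le> a"
      unfolding a_def L1_norm_def using t k0 \<sigma>0 set_integral_mono_set[OF in_L1_norm[OF FL], of t]
      by (intro mult_left_mono) (auto intro: add_mono mult_right_mono simp: add.commute)
    finally show "norm (x\<^sub>1 t - x\<^sub>2 t) \<le> a + m * (exp (\<sigma> * \<kappa> * t) - 1)"
      by simp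
  qed
  then show "norm (x\<^sub>1 t - x\<^sub>2 t) \<le> \<sigma> * exp (\<sigma> * \<kappa> * T) *
    (L1_norm T (\<lambda>t. F\<^sub>1 t - F\<^sub>2 t) + T * kernel_norm T (\<lambda>t. K\<^sub>1 t - K\<^sub>2 t) * C_norm T x\<^sub>2)"
    by (simp add: a_def k_def mult_ac)
qed

section \<open>Regularity of the induced pair\<close>

lemma in_L1_strongly_continuous: "strongly_continuous T L \<Longrightarrow> in_L1 T (\<lambda>t. blinfun_apply (L t) y)"
  unfolding strongly_continuous_def by (auto intro: in_L1_continuous)

lemma hidden_realisation_strongly_continuous:
  "hidden_realisation T R \<Longrightarrow> strongly_continuous T (semigroup_of R)"
  unfolding hidden_realisation_def by (auto intro: C0_semigroup_strongly_continuous)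

text \<open>With \<open>B\<close> outermost, what remains is the hidden state, which can be
  estimated on its own.\<close>

lemma induced_F_eq:
  "induced_F R t = B_of R (semigroup_of R t (init_of R) + conv (semigroup_of R) (force_of R) t)"
  by (simp add: induced_F_def conv_def blinfun.add_right)

lemma in_L1_hidden_state:
  assumes "hidden_realisation T R"
  shows "in_L1 T (\<lambda>t. semigroup_of R t y + conv (semigroup_of R) (force_of R) t)"
  using hidden_realisation_strongly_continuous[OF assms] assms
  by (intro in_L1_add in_L1_conv in_L1_strongly_continuous) (auto simp: hidden_realisation_def)

lemma in_L1_induced_F: "hidden_realisation T R \<Longrightarrow> in_L1 T (induced_F R)"
  using in_L1_blinfun[OF in_L1_hidden_state] by (simp add: induced_F_eq[abs_def])

lemma resolved_trajectory_stability:
  fixes S :: "real \<Rightarrow> 'r::{banach, second_countable_topology} \<Rightarrow>\<^sub>L 'r"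
  assumes "0 \<le> T" "strongly_continuous T S" "\<And>t. t \<in> {0..T} \<Longrightarrow> norm (S t) \<le> \<sigma>" "in_L1 T f"
    and "hidden_realisation T R\<^sub>1" "hidden_realisation T R\<^sub>2"
    and "resolved_trajectory S T x0 f R\<^sub>1 x\<^sub>1" "resolved_trajectory S T x0 f R\<^sub>2 x\<^sub>2"
    and "kernel_norm T (induced_K R\<^sub>1) \<le> \<kappa>"
  shows "C_norm T (\<lambda>t. x\<^sub>1 t - x\<^sub>2 t) \<le> \<sigma> * exp (\<sigma> * \<kappa> * T) *
    (L1_norm T (\<lambda>t. induced_F R\<^sub>1 t - induced_F R\<^sub>2 t) +
     T * kernel_norm T (\<lambda>t. induced_K R\<^sub>1 t - induced_K R\<^sub>2 t) * C_norm T x\<^sub>2)"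
  using assms unfolding resolved_trajectory_def
  by (intro mild_solution_stability in_L1_induced_F strongly_continuous_induced_K
      hidden_realisation_strongly_continuous)

section \<open>Dependence of the induced pair on the realisation\<close>

lemma L1_norm_le:
  fixes \<phi> :: "real \<Rightarrow> real"
  assumes "in_L1 T h" "set_integrable lborel {0..T} \<phi>" "\<And>t. t \<in> {0..T} \<Longrightarrow> norm (h t) \<le> \<phi> t"
  shows "L1_norm T h \<le> (LINT t:{0..T}|lborel. \<phi> t)"
  unfolding L1_norm_def by (intro set_integral_mono in_L1_norm assms)

lemma L1_norm_add_le: "in_L1 T g \<Longrightarrow> in_L1 T h \<Longrightarrow> L1_norm T (\<lambda>t. g t + h t) \<le> L1_norm T g + L1_norm T h"
  using L1_norm_le[OF in_L1_add, of T g h "\<lambda>t. norm (g t) + norm (h t)"]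
  by (simp add: L1_norm_def in_L1_norm set_integral_add norm_triangle_ineq)

lemma L1_norm_blinfun_le:
  fixes B :: "'a::{banach, second_countable_topology} \<Rightarrow>\<^sub>L 'b::{banach, second_countable_topology}"
  shows "in_L1 T h \<Longrightarrow> L1_norm T (\<lambda>t. blinfun_apply B (h t)) \<le> norm B * L1_norm T h"
  using L1_norm_le[OF in_L1_blinfun, of T h "\<lambda>t. norm B * norm (h t)" B]
  by (simp add: L1_norm_def in_L1_norm set_integrable_mult_right norm_blinfun)

lemma L1_norm_apply_le:
  fixes L :: "real \<Rightarrow> 'a::{banach, second_countable_topology} \<Rightarrow>\<^sub>L 'b::{banach, second_countable_topology}"
  assumes "strongly_continuous T L"
  shows "L1_norm T (\<lambda>t. blinfun_apply (L t) y) \<le> kernel_norm T L * norm y"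
  using L1_norm_le[OF in_L1_strongly_continuous[OF assms],
      of "\<lambda>t. norm (L t) * norm y" y] strongly_continuous_norm_integrable[OF assms]
  by (simp add: kernel_norm_def set_integrable_mult_left norm_blinfun)

lemma kernel_norm_le:
  fixes L :: "real \<Rightarrow> 'a::banach \<Rightarrow>\<^sub>L 'b::real_normed_vector"
  assumes "strongly_continuous T L" "0 \<le> T" "\<And>t. t \<in> {0..T} \<Longrightarrow> norm (L t) \<le> b"
  shows "kernel_norm T L \<le> T * b"
proof -
  have "kernel_norm T L \<le> (LINT t:{0..T}|lborel. b)"
    unfolding kernel_norm_def
    using in_L1_continuous[of T "\<lambda>_. b"] assms(3)
    by (intro set_integral_mono strongly_continuous_norm_integrable[OF assms(1)]) (auto simp: in_L1_def)
  then show ?thesis using assms(2) by (simp add: set_integral_const)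
qed

lemma norm_compose3_le:
  "norm (B o\<^sub>L S o\<^sub>L C) \<le> norm B * norm S * norm C"
  by (intro order_trans[OF norm_blinfun_compose] mult_right_mono norm_blinfun_compose norm_ge_zero)

lemma norm_induced_K_le:
  "norm (semigroup_of R t) \<le> N \<Longrightarrow> norm (induced_K R t) \<le> norm (B_of R) * N * norm (C_of R)"
  unfolding induced_K_def
  by (intro order_trans[OF norm_compose3_le] mult_right_mono mult_left_mono norm_ge_zero)

text \<open>\<open>B\<close>, \<open>S\<close> and \<open>C\<close> are exchanged one at a time. The
  semigroup difference is to be small only in the integrated norm, so it stays under the integral,
  while the other two terms use the uniform bound \<open>N\<close>, once for each semigroup.\<close>

lemma kernel_norm_induced_K_diff_le:
  fixes R\<^sub>1 R\<^sub>2 :: "('r::banach, 'u::{banach, second_countable_topology}) realisation"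
  assumes T: "0 \<le> T" and R: "hidden_realisation T R\<^sub>1" "hidden_realisation T R\<^sub>2"
    and N: "\<And>t. t \<in> {0..T} \<Longrightarrow> norm (semigroup_of R\<^sub>1 t) \<le> N"
      "\<And>t. t \<in> {0..T} \<Longrightarrow> norm (semigroup_of R\<^sub>2 t) \<le> N"
  shows "kernel_norm T (\<lambda>t. induced_K R\<^sub>1 t - induced_K R\<^sub>2 t) \<le>
    T * (norm (B_of R\<^sub>1 - B_of R\<^sub>2) * N * norm (C_of R\<^sub>1)) +
    norm (B_of R\<^sub>2) * kernel_norm T (\<lambda>t. semigroup_of R\<^sub>1 t - semigroup_of R\<^sub>2 t) * norm (C_of R\<^sub>1) +
    T * (norm (B_of R\<^sub>2) * N * norm (C_of R\<^sub>1 - C_of R\<^sub>2))"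
    (is "_ \<le> T * ?a + ?b * ?k * ?c + T * ?d")
proof -
  let ?\<delta> = "\<lambda>t. norm (semigroup_of R\<^sub>1 t - semigroup_of R\<^sub>2 t)"
  note sc = hidden_realisation_strongly_continuous[OF R(1)] hidden_realisation_strongly_continuous[OF R(2)]
  have const: "set_integrable lborel {0..T} (\<lambda>_. b :: real)" for b
    using in_L1_continuous[of T "\<lambda>_. b"] by (simp add: in_L1_def)
  have \<delta>: "set_integrable lborel {0..T} ?\<delta>"
    by (intro strongly_continuous_norm_integrable strongly_continuous_diff sc)
  have le: "norm (induced_K R\<^sub>1 t - induced_K R\<^sub>2 t) \<le> ?a + ?b * ?\<delta> t * ?c + ?d" if t: "t \<in> {0..T}" for t
  proof -
    have "induced_K R\<^sub>1 t - induced_K R\<^sub>2 t =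
        ((B_of R\<^sub>1 - B_of R\<^sub>2) o\<^sub>L semigroup_of R\<^sub>1 t o\<^sub>L C_of R\<^sub>1) +
        (B_of R\<^sub>2 o\<^sub>L (semigroup_of R\<^sub>1 t - semigroup_of R\<^sub>2 t) o\<^sub>L C_of R\<^sub>1) +
        (B_of R\<^sub>2 o\<^sub>L semigroup_of R\<^sub>2 t o\<^sub>L (C_of R\<^sub>1 - C_of R\<^sub>2))"
      by (rule blinfun_eqI)
        (simp add: induced_K_def blinfun.add_left blinfun.diff_left blinfun.diff_right)
    also have "norm \<dots> \<le> ?a + ?b * ?\<delta> t * ?c + ?d"
      using N[OF t]
      by (intro norm_triangle_le add_mono order_trans[OF norm_compose3_le] mult_mono
          mult_nonneg_nonneg norm_ge_zero order_refl order_trans[OF norm_ge_zero N(1)[OF t]])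
    finally show ?thesis .
  qed
  have "kernel_norm T (\<lambda>t. induced_K R\<^sub>1 t - induced_K R\<^sub>2 t)
      \<le> (LINT t:{0..T}|lborel. ?a + ?b * ?\<delta> t * ?c + ?d)"
    unfolding kernel_norm_def
    by (intro set_integral_mono strongly_continuous_norm_integrable strongly_continuous_diff
        strongly_continuous_induced_K sc le set_integral_add set_integrable_mult_left
        set_integrable_mult_right const \<delta>)
  also have "\<dots> = T * ?a + ?b * ?k * ?c + T * ?d"
    using T by (simp add: set_integral_add set_integrable_mult_left set_integrable_mult_right const \<delta>
        set_integral_const kernel_norm_def)
  finally show ?thesis .
qed

text \<open>The difference splits into \<open>S\<close> acting on \<open>y - y'\<close> and
  \<open>g - g'\<close>, plus \<open>S - S'\<close> acting on \<open>y'\<close> and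
  \<open>g'\<close>. Young's inequality handles both convolutions, so no pointwise smallness of
  \<open>S - S'\<close> is involved.\<close>

lemma L1_norm_hidden_state_diff_le:
  fixes S S' :: "real \<Rightarrow> 'a::{banach, second_countable_topology} \<Rightarrow>\<^sub>L 'b::{banach, second_countable_topology}"
  assumes T: "0 \<le> T" and S: "strongly_continuous T S" "strongly_continuous T S'"
    and g: "in_L1 T g" "in_L1 T g'"
    and N: "\<And>t. t \<in> {0..T} \<Longrightarrow> norm (S t) \<le> N"
  shows "L1_norm T (\<lambda>t. (S t y + conv S g t) - (S' t y' + conv S' g' t)) \<le>
    T * N * (norm (y - y') + L1_norm T (\<lambda>t. g t - g' t)) +
    kernel_norm T (\<lambda>t. S t - S' t) * (norm y' + L1_norm T g')"
proof -
  note D = strongly_continuous_diff[OF S] and gd = in_L1_diff[OF g]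
  have kS: "kernel_norm T S \<le> T * N" by (rule kernel_norm_le[OF S(1) T N])
  have "L1_norm T (\<lambda>t. (S t y + conv S g t) - (S' t y' + conv S' g' t)) =
      L1_norm T (\<lambda>t. (S t (y - y') + conv S (\<lambda>t. g t - g' t) t) +
        ((S t - S' t) y' + conv (\<lambda>t. S t - S' t) g' t))"
    \<comment> \<open>The splitting is valid pointwise on the interval, where the convolutions are
      linear in each factor.\<close>
    unfolding L1_norm_def
    by (intro set_lebesgue_integral_cong allI impI)
      (simp_all add: conv_diff_right[OF S(1) g] conv_diff_left[OF S g(2)]
        blinfun.diff_left blinfun.diff_right algebra_simps)
  also have "\<dots> \<le> (kernel_norm T S * norm (y - y') + kernel_norm T S * L1_norm T (\<lambda>t. g t - g' t)) +
      (kernel_norm T (\<lambda>t. S t - S' t) * norm y' + kernel_norm T (\<lambda>t. S t - S' t) * L1_norm T g')"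
    by (intro order_trans[OF L1_norm_add_le] add_mono L1_norm_apply_le L1_norm_conv_le T D gd S g
        in_L1_add in_L1_conv in_L1_strongly_continuous)
  also have "\<dots> = kernel_norm T S * (norm (y - y') + L1_norm T (\<lambda>t. g t - g' t)) +
      kernel_norm T (\<lambda>t. S t - S' t) * (norm y' + L1_norm T g')"
    by (simp add: algebra_simps)
  also have "\<dots> \<le> T * N * (norm (y - y') + L1_norm T (\<lambda>t. g t - g' t)) +
      kernel_norm T (\<lambda>t. S t - S' t) * (norm y' + L1_norm T g')"
    by (intro add_right_mono mult_right_mono kS add_nonneg_nonneg norm_ge_zero L1_norm_nonneg)
  finally show ?thesis .
qed

text \<open>The hidden state \<open>z\<close> multiplying the difference of the \<open>B\<close>
  operators belongs to the second realisation. When that one is the limit, its norm is a fixed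
  number along the sequence.\<close>

lemma L1_norm_induced_F_diff_le:
  fixes R\<^sub>1 R\<^sub>2 :: "('r::{banach, second_countable_topology}, 'u::{banach, second_countable_topology}) realisation"
  assumes T: "0 \<le> T" and R: "hidden_realisation T R\<^sub>1" "hidden_realisation T R\<^sub>2"
    and N: "\<And>t. t \<in> {0..T} \<Longrightarrow> norm (semigroup_of R\<^sub>1 t) \<le> N"
  defines "z \<equiv> \<lambda>t. semigroup_of R\<^sub>2 t (init_of R\<^sub>2) + conv (semigroup_of R\<^sub>2) (force_of R\<^sub>2) t"
  shows "L1_norm T (\<lambda>t. induced_F R\<^sub>1 t - induced_F R\<^sub>2 t) \<le>
    norm (B_of R\<^sub>1) *
      (T * N * (norm (init_of R\<^sub>1 - init_of R\<^sub>2) + L1_norm T (\<lambda>t. force_of R\<^sub>1 t - force_of R\<^sub>2 t)) +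
       kernel_norm T (\<lambda>t. semigroup_of R\<^sub>1 t - semigroup_of R\<^sub>2 t) *
         (norm (init_of R\<^sub>2) + L1_norm T (force_of R\<^sub>2))) +
    norm (B_of R\<^sub>1 - B_of R\<^sub>2) * L1_norm T z"
proof -
  define w where "w t = semigroup_of R\<^sub>1 t (init_of R\<^sub>1) + conv (semigroup_of R\<^sub>1) (force_of R\<^sub>1) t" for t
  have w: "in_L1 T w" and z: "in_L1 T z"
    unfolding w_def z_def by (intro in_L1_hidden_state R)+
  have "L1_norm T (\<lambda>t. induced_F R\<^sub>1 t - induced_F R\<^sub>2 t) =
      L1_norm T (\<lambda>t. B_of R\<^sub>1 (w t - z t) + (B_of R\<^sub>1 - B_of R\<^sub>2) (z t))"
    by (simp add: induced_F_eq w_def z_def blinfun.diff_left blinfun.diff_right)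
  also have "\<dots> \<le> norm (B_of R\<^sub>1) * L1_norm T (\<lambda>t. w t - z t) + norm (B_of R\<^sub>1 - B_of R\<^sub>2) * L1_norm T z"
    by (intro order_trans[OF L1_norm_add_le] add_mono L1_norm_blinfun_le in_L1_blinfun in_L1_diff w z)
  also have "L1_norm T (\<lambda>t. w t - z t) \<le>
      T * N * (norm (init_of R\<^sub>1 - init_of R\<^sub>2) + L1_norm T (\<lambda>t. force_of R\<^sub>1 t - force_of R\<^sub>2 t)) +
      kernel_norm T (\<lambda>t. semigroup_of R\<^sub>1 t - semigroup_of R\<^sub>2 t) *
         (norm (init_of R\<^sub>2) + L1_norm T (force_of R\<^sub>2))"
    unfolding w_def z_def using R
    by (intro L1_norm_hidden_state_diff_le T hidden_realisation_strongly_continuous N)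
      (auto simp: hidden_realisation_def)
  finally show ?thesis by (simp add: mult_left_mono)
qed

section \<open>Convergence along a sequence of realisations\<close>

text \<open>Stability is applied with the limit in the second place, so the factor
  \<open>C_norm T x\<close> does not vary with \<open>n\<close>.\<close>

lemma resolved_trajectory_convergence:
  fixes S :: "real \<Rightarrow> 'r::{banach, second_countable_topology} \<Rightarrow>\<^sub>L 'r"
    and Rn :: "nat \<Rightarrow> ('r, 'u::{banach, second_countable_topology}) realisation"
  assumes T: "0 \<le> T" and S: "strongly_continuous T S"
    and \<sigma>: "\<And>t. t \<in> {0..T} \<Longrightarrow> norm (S t) \<le> \<sigma>" and f: "in_L1 T f"
    and Rn: "\<And>n. hidden_realisation T (Rn n)" and R: "hidden_realisation T R"
    and N: "\<And>n t. t \<in> {0..T} \<Longrightarrow> norm (semigroup_of (Rn n) t) \<le> N"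
      "\<And>t. t \<in> {0..T} \<Longrightarrow> norm (semigroup_of R t) \<le> N"
    and lim_S: "(\<lambda>n. kernel_norm T (\<lambda>t. semigroup_of (Rn n) t - semigroup_of R t)) \<longlonglongrightarrow> 0"
    and lim_B: "(\<lambda>n. B_of (Rn n)) \<longlonglongrightarrow> B_of R"
    and lim_C: "(\<lambda>n. C_of (Rn n)) \<longlonglongrightarrow> C_of R"
    and lim_y: "(\<lambda>n. init_of (Rn n)) \<longlonglongrightarrow> init_of R"
    and lim_g: "(\<lambda>n. L1_norm T (\<lambda>t. force_of (Rn n) t - force_of R t)) \<longlonglongrightarrow> 0"
    and xn: "\<And>n. resolved_trajectory S T x0 f (Rn n) (xn n)"
    and x: "resolved_trajectory S T x0 f R x"
  shows "(\<lambda>n. C_norm T (\<lambda>t. xn n t - x t)) \<longlonglongrightarrow> 0"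
proof -
  have N0: "0 \<le> N" using order_trans[OF norm_ge_zero N(2)[of 0]] T by simp
  \<comment> \<open>Convergent sequences are bounded; \<open>b\<close> and \<open>c\<close> then
    give one exponent \<open>\<kappa>\<close> valid for every \<open>n\<close>.\<close>
  obtain b where b: "\<And>n. norm (B_of (Rn n)) \<le> b"
    using lim_B by (metis Bseq_def convergentI convergent_imp_Bseq)
  obtain c where c: "\<And>n. norm (C_of (Rn n)) \<le> c"
    using lim_C by (metis Bseq_def convergentI convergent_imp_Bseq)
  have b0: "0 \<le> b" by (rule order_trans[OF norm_ge_zero b])
  define \<kappa> where "\<kappa> = T * (b * N * c)"
  have \<kappa>: "kernel_norm T (induced_K (Rn n)) \<le> \<kappa>" for n
    unfolding \<kappa>_def
  proof (rule kernel_norm_le[OF _ T])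
    fix t assume "t \<in> {0..T}"
    then have "norm (induced_K (Rn n) t) \<le> norm (B_of (Rn n)) * N * norm (C_of (Rn n))"
      by (intro norm_induced_K_le N)
    also have "\<dots> \<le> b * N * c"
      by (intro mult_mono b c mult_nonneg_nonneg b0 N0 norm_ge_zero order_refl)
    finally show "norm (induced_K (Rn n) t) \<le> b * N * c" .
  qed (intro strongly_continuous_induced_K hidden_realisation_strongly_continuous Rn)
  have lim_K: "(\<lambda>n. kernel_norm T (\<lambda>t. induced_K (Rn n) t - induced_K R t)) \<longlonglongrightarrow> 0"
  proof (rule tendsto_sandwich[OF always_eventually always_eventually tendsto_const])
    show "\<forall>n. 0 \<le> kernel_norm T (\<lambda>t. induced_K (Rn n) t - induced_K R t)"
      by (intro allI kernel_norm_nonneg)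
    show "\<forall>n. kernel_norm T (\<lambda>t. induced_K (Rn n) t - induced_K R t) \<le>
        T * (norm (B_of (Rn n) - B_of R) * N * norm (C_of (Rn n))) +
        norm (B_of R) * kernel_norm T (\<lambda>t. semigroup_of (Rn n) t - semigroup_of R t) *
          norm (C_of (Rn n)) +
        T * (norm (B_of R) * N * norm (C_of (Rn n) - C_of R))"
      by (intro allI kernel_norm_induced_K_diff_le T Rn R N)
  \<comment> \<open>Each summand of the upper bound has one factor tending to zero, and its
    remaining factors converge.\<close>
  qed (auto intro!: tendsto_eq_intros lim_B lim_C lim_S)
  have lim_F: "(\<lambda>n. L1_norm T (\<lambda>t. induced_F (Rn n) t - induced_F R t)) \<longlonglongrightarrow> 0"
  proof (rule tendsto_sandwich[OF always_eventually always_eventually tendsto_const])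
    show "\<forall>n. 0 \<le> L1_norm T (\<lambda>t. induced_F (Rn n) t - induced_F R t)"
      by (intro allI L1_norm_nonneg)
    show "\<forall>n. L1_norm T (\<lambda>t. induced_F (Rn n) t - induced_F R t) \<le>
        norm (B_of (Rn n)) *
          (T * N * (norm (init_of (Rn n) - init_of R) +
             L1_norm T (\<lambda>t. force_of (Rn n) t - force_of R t)) +
           kernel_norm T (\<lambda>t. semigroup_of (Rn n) t - semigroup_of R t) *
             (norm (init_of R) + L1_norm T (force_of R))) +
        norm (B_of (Rn n) - B_of R) * L1_norm T
          (\<lambda>t. semigroup_of R t (init_of R) + conv (semigroup_of R) (force_of R) t)"
      by (intro allI L1_norm_induced_F_diff_le T Rn R N)
  qed (auto intro!: tendsto_eq_intros lim_B lim_y lim_g lim_S)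
  have "(\<lambda>n. \<sigma> * exp (\<sigma> * \<kappa> * T) * (L1_norm T (\<lambda>t. induced_F (Rn n) t - induced_F R t) +
      T * kernel_norm T (\<lambda>t. induced_K (Rn n) t - induced_K R t) * C_norm T x)) \<longlonglongrightarrow> 0"
    by (auto intro!: tendsto_eq_intros lim_K lim_F)
  then show ?thesis
  proof (rule tendsto_sandwich[OF _ _ tendsto_const, rotated -1])
    have "continuous_on {0..T} (\<lambda>t. xn n t - x t)" for n
      using xn x by (auto simp: resolved_trajectory_def mild_solution_def intro: continuous_intros)
    then have "0 \<le> C_norm T (\<lambda>t. xn n t - x t)" for n
      by (rule order_trans[OF norm_ge_zero norm_le_C_norm[of T _ 0]]) (use T in simp)
    then show "\<forall>\<^sub>F n in sequentially. 0 \<le> C_norm T (\<lambda>t. xn n t - x t)"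
      by simp
    show "\<forall>\<^sub>F n in sequentially. C_norm T (\<lambda>t. xn n t - x t) \<le> \<sigma> * exp (\<sigma> * \<kappa> * T) *
        (L1_norm T (\<lambda>t. induced_F (Rn n) t - induced_F R t) +
         T * kernel_norm T (\<lambda>t. induced_K (Rn n) t - induced_K R t) * C_norm T x)"
      by (intro always_eventually allI resolved_trajectory_stability[OF T S \<sigma> f Rn R xn x \<kappa>])
  qed
qed

theorem theorem5p4:
  fixes A :: "('r::{real_inner, banach, second_countable_topology} \<times> 'r) set"
    and S\<^sub>A :: "real \<Rightarrow> 'r \<Rightarrow>\<^sub>L 'r"
    and T M \<omega> :: real
    and f :: "real \<Rightarrow> 'r"
    and x0 :: 'r
  assumes "T > 0"
    and "generates A S\<^sub>A"
    and "M \<ge> 1"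
    and "\<And>t. t \<ge> 0 \<Longrightarrow> norm (S\<^sub>A t) \<le> M * exp (\<omega> * t)"
    and "in_L1 T f"
  shows
    "(\<forall>(R1 :: ('r, 'u::{real_inner, banach, second_countable_topology}) realisation)
       (R2 :: ('r, 'u) realisation) x1 x2.
        hidden_realisation T R1 \<longrightarrow> hidden_realisation T R2 \<longrightarrow>
        resolved_trajectory S\<^sub>A T x0 f R1 x1 \<longrightarrow> resolved_trajectory S\<^sub>A T x0 f R2 x2 \<longrightarrow>
        (let \<kappa> = max (kernel_norm T (induced_K R1)) (kernel_norm T (induced_K R2));
             \<sigma> = growth_factor M \<omega> T
         in C_norm T (\<lambda>t. x1 t - x2 t) \<le>
              \<sigma> * exp (\<sigma> * \<kappa> * T) *
                (L1_norm T (\<lambda>t. induced_F R1 t - induced_F R2 t) +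
                 T * kernel_norm T (\<lambda>t. induced_K R1 t - induced_K R2 t) * C_norm T x2)))
     \<and>
     (\<forall>(Rn :: nat \<Rightarrow> ('r, 'u) realisation) (R :: ('r, 'u) realisation) xn x.
        (\<forall>n. hidden_realisation T (Rn n)) \<longrightarrow> hidden_realisation T R \<longrightarrow>
        max (SUP n. SUP t\<in>{0..T}. ennreal (norm (semigroup_of (Rn n) t)))
            (SUP t\<in>{0..T}. ennreal (norm (semigroup_of R t))) < \<infinity> \<longrightarrow>
        (\<lambda>n. LINT t:{0..T}|lborel. norm (semigroup_of (Rn n) t - semigroup_of R t))
            \<longlonglongrightarrow> 0 \<longrightarrow>
        (\<lambda>n. norm (B_of (Rn n) - B_of R)) \<longlonglongrightarrow> 0 \<longrightarrow>
        (\<lambda>n. norm (C_of (Rn n) - C_of R)) \<longlonglongrightarrow> 0 \<longrightarrow>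
        (\<lambda>n. norm (init_of (Rn n) - init_of R)) \<longlonglongrightarrow> 0 \<longrightarrow>
        (\<lambda>n. L1_norm T (\<lambda>t. force_of (Rn n) t - force_of R t)) \<longlonglongrightarrow> 0 \<longrightarrow>
        (\<forall>n. resolved_trajectory S\<^sub>A T x0 f (Rn n) (xn n)) \<longrightarrow>
        resolved_trajectory S\<^sub>A T x0 f R x \<longrightarrow>
        (\<lambda>n. C_norm T (\<lambda>t. xn n t - x t)) \<longlonglongrightarrow> 0)"
proof -
  define \<sigma> where "\<sigma> = growth_factor M \<omega> T"
  have T: "0 \<le> T" using assms(1) by simp
  have S: "strongly_continuous T S\<^sub>A"
    using assms(2) unfolding generates_def by (auto intro: C0_semigroup_strongly_continuous)
  have \<sigma>: "norm (S\<^sub>A t) \<le> \<sigma>" if t: "t \<in> {0..T}" for t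
  proof -
    \<comment> \<open>Replacing \<omega> by its positive part makes the exponent monotone in time,
      so its value at \<open>T\<close> dominates also for negative \<omega>.\<close>
    have "\<omega> * t \<le> max \<omega> 0 * T"
      using t by (intro mult_mono) auto
    moreover have "norm (S\<^sub>A t) \<le> M * exp (\<omega> * t)"
      using t by (intro assms(4)) simp
    ultimately show ?thesis
      unfolding \<sigma>_def growth_factor_def using assms(3) by (smt (verit) exp_le_cancel_iff mult_left_mono)
  qed
  show ?thesis
  proof (intro conjI allI impI, goal_cases)
    case (1 R1 R2 x1 x2)
    then show ?case
      unfolding Let_def
      \<comment> \<open>The maximum enters as an upper bound for the norm of the first
        kernel.\<close>
      by (intro resolved_trajectory_stability[OF T S \<sigma>[unfolded \<sigma>_def] assms(5)]) auto
  next
    case (2 Rn R xn x)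
    \<comment> \<open>In the extended nonnegative reals every member lies below its supremum, with
      no separate proof of boundedness.\<close>
    define c where "c = max (SUP n. SUP t\<in>{0..T}. ennreal (norm (semigroup_of (Rn n) t)))
            (SUP t\<in>{0..T}. ennreal (norm (semigroup_of R t)))"
    have c: "c < \<infinity>" using 2(3) unfolding c_def .
    have "ennreal (norm (semigroup_of (Rn n) t)) \<le> c" if "t \<in> {0..T}" for n t
      unfolding c_def using that
      by (intro max.coboundedI1 SUP_upper2[of n UNIV] SUP_upper) auto
    \<comment> \<open>Finiteness of \<open>c\<close> is essential here: \<open>enn2real\<close>
      sends infinity to 0 and is monotone only below it.\<close>
    then have N1: "norm (semigroup_of (Rn n) t) \<le> enn2real c" if "t \<in> {0..T}" for n t
      using that c enn2real_mono[of "ennreal (norm (semigroup_of (Rn n) t))" c] by fastforce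
    have "ennreal (norm (semigroup_of R t)) \<le> c" if "t \<in> {0..T}" for t
      unfolding c_def using that by (intro max.coboundedI2 SUP_upper)
    then have N2: "norm (semigroup_of R t) \<le> enn2real c" if "t \<in> {0..T}" for t
      using that c enn2real_mono[of "ennreal (norm (semigroup_of R t))" c] by fastforce
    show ?case
    proof (rule resolved_trajectory_convergence[OF T S \<sigma> assms(5)])
      show "(\<lambda>n. kernel_norm T (\<lambda>t. semigroup_of (Rn n) t - semigroup_of R t)) \<longlonglongrightarrow> 0"
        using 2(4) by (simp add: kernel_norm_def)
      show "(\<lambda>n. B_of (Rn n)) \<longlonglongrightarrow> B_of R" "(\<lambda>n. C_of (Rn n)) \<longlonglongrightarrow> C_of R"
        "(\<lambda>n. init_of (Rn n)) \<longlonglongrightarrow> init_of R"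
        using 2(5-7) by (auto intro: LIM_zero_cancel tendsto_norm_zero_cancel)
    qed (use 2 N1 N2 in auto)
  qed
qed

end
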